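(* Let $b\ge2$ be an integer and $\mathbf{x}=x_1x_2\ldots$ a Sturmian word over $\{0,1,\ldots,b-1\}$. Then $$\mu\Big(\sum_{k\ge1}\frac{x_k}{b^k}\Big)=\frac{\mathrm{rep}(\mathbf{x})}{\mathrm{rep}(\mathbf{x})-1},$$ where the right-hand side is $+\infty$ if $\mathrm{rep}(\mathbf{x})=1$.
   Context: A Sturmian word is an infinite word with exactly $n+1$ distinct factors of length $n$ for every $n\ge1$. With $x_i^j=x_i\cdots x_j$, $r(n,\mathbf{x})=\min\{m\ge1:\ x_i^{i+n-1}=x_{m-n+1}^{m}\text{ for some } 1\le i\le m-n\}$ and $\mathrm{rep}(\mathbf{x})=\liminf_{n\to\infty}r(n,\mathbf{x})/n$. The irrationality exponent $\mu(\xi)$ is the supremum of the real $\mu$ such that $|\xi-p/q|<q^{-\mu}$ has infinitely many rational solutions $p/q$. *)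

theory Defs
  imports "HOL-Analysis.Analysis" "HOL-Library.Liminf_Limsup"
begin

text \<open>Infinite words are functions x :: nat => nat, indexed from 1 (x 0 is ignored).
  The factor x_i^j = x_i ... x_j is the list map x [i..<j+1].\<close>

definition factors_of_length :: "(nat \<Rightarrow> nat) \<Rightarrow> nat \<Rightarrow> nat list set" where
  "factors_of_length x n = {map x [i..<i+n] | i. 1 \<le> i}"

definition sturmian :: "(nat \<Rightarrow> nat) \<Rightarrow> bool" where
  "sturmian x \<longleftrightarrow> (\<forall>n\<ge>1. card (factors_of_length x n) = n + 1)"

definition rfun :: "nat \<Rightarrow> (nat \<Rightarrow> nat) \<Rightarrow> nat" where
  "rfun n x = (LEAST m. 1 \<le> m \<and>
     (\<exists>i. 1 \<le> i \<and> i + n \<le> m \<and> map x [i..<i+n] = map x [m+1-n..<m+1]))"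

definition rep :: "(nat \<Rightarrow> nat) \<Rightarrow> ereal" where
  "rep x = liminf (\<lambda>n. ereal (real (rfun n x) / real n))"

definition irrationality_exponent :: "real \<Rightarrow> ereal" where
  "irrationality_exponent \<xi> = Sup (ereal ` {\<mu> :: real.
     infinite {r :: rat. \<bar>\<xi> - of_rat r\<bar> < real_of_int (snd (quotient_of r)) powr (- \<mu>)}})"

end

theory Submission
  imports Defs
begin

text \<open>A repetition of length \<open>n\<close> ending at position \<open>r(n)\<close> yields an eventually periodic
  expansion that agrees with that of \<open>\<xi>\<close> up to \<open>r(n)\<close>, hence a rational with denominator at most
  \<open>b^(r(n) - n)\<close> at distance at most \<open>b^(-r(n))\<close> from \<open>\<xi>\<close>; this gives the lower bound for the
  exponent. Call \<open>n\<close> a jump if \<open>r(n + 1) \<noteq> r(n) + 1\<close>. For a Sturmian word a jump \<open>n\<close> forces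
  \<open>r(n + 1) = 2 n + 3\<close>, so consecutive jumps \<open>u < v\<close> satisfy \<open>r(v) = v + u + 2\<close>. The
  approximants at the jumps are therefore so dense that every fraction with denominator \<open>q\<close> is
  either such an approximant, essentially in lowest terms, or no closer to \<open>\<xi>\<close> than a constant
  times \<open>q^(-2)\<close>. Since \<open>rep \<le> 2\<close>, the approximants alone decide the exponent.\<close>

section \<open>Factors and their first repetition\<close>

definition factor_at :: "(nat \<Rightarrow> nat) \<Rightarrow> nat \<Rightarrow> nat \<Rightarrow> nat list" where
  "factor_at x n i = map x [i..<i + n]"

lemma factor_at_eq_iff:
  "factor_at x n i = factor_at x n k \<longleftrightarrow> (\<forall>t<n. x (i + t) = x (k + t))"
  by (auto simp: factor_at_def list_eq_iff_nth_eq)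

lemma factor_at_Suc_eq_iff:
  "factor_at x (Suc n) i = factor_at x (Suc n) k \<longleftrightarrow>
     factor_at x n i = factor_at x n k \<and> x (i + n) = x (k + n)"
  by (auto simp: factor_at_eq_iff less_Suc_eq)

lemma factor_at_Suc_tail:
  "factor_at x (Suc n) i = factor_at x (Suc n) k \<Longrightarrow> factor_at x n (Suc i) = factor_at x n (Suc k)"
  by (force simp: factor_at_eq_iff)

lemma take_factor_at: "take n (factor_at x (Suc n) i) = factor_at x n i"
  by (simp add: factor_at_def)

lemma factors_of_length_eq: "factors_of_length x n = factor_at x n ` {1..}"
  by (auto simp: factors_of_length_def factor_at_def)

text \<open>Records where the repeated occurrence starts, whereas \<open>rfun\<close> records where
  it ends; starting positions stay comparable when \<open>n\<close> grows.\<close>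

definition first_repeat :: "(nat \<Rightarrow> nat) \<Rightarrow> nat \<Rightarrow> nat" where
  "first_repeat x n = (LEAST j. \<exists>i. 1 \<le> i \<and> i < j \<and> factor_at x n i = factor_at x n j)"

locale sturmian_word =
  fixes x :: "nat \<Rightarrow> nat"
  assumes sturmian: "sturmian x"
begin

abbreviation fac where "fac \<equiv> factor_at x"
abbreviation fr where "fr \<equiv> first_repeat x"

lemma card_factors: "card (factors_of_length x n) = n + 1"
proof (cases "n = 0")
  case True
  have "factors_of_length x 0 = {[]}"
    by (auto simp: factors_of_length_def)
  then show ?thesis using True by simp
next
  case False
  then show ?thesis using sturmian by (simp add: sturmian_def)
qed

lemma finite_factors: "finite (factors_of_length x n)"
  using card_factors[of n] card.infinite by fastforce

lemma fac_in: "1 \<le> i \<Longrightarrow> fac n i \<in> factors_of_length x n"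
  by (auto simp: factors_of_length_eq)

text \<open>Truncation maps the \<open>n + 2\<close> factors of length \<open>n + 1\<close> onto the \<open>n + 1\<close> factors of
  length \<open>n\<close>, so two of them cannot both be redundant.\<close>

lemma one_redundant_factor:
  assumes "u \<in> factors_of_length x (Suc n)" "u' \<in> factors_of_length x (Suc n)" "u \<noteq> u'"
    and "v \<in> factors_of_length x (Suc n) - {u, u'}" "v' \<in> factors_of_length x (Suc n) - {u, u'}"
    and "take n v = take n u" "take n v' = take n u'"
  shows False
proof -
  let ?A = "factors_of_length x (Suc n)"
  have im: "take n ` ?A = factors_of_length x n"
    by (simp add: factors_of_length_eq image_image take_factor_at)
  have "take n ` ?A \<subseteq> take n ` (?A - {u, u'})"
  proof
    fix z assume "z \<in> take n ` ?A"
    then obtain w where w: "w \<in> ?A" "z = take n w" by auto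
    consider "w = u" | "w = u'" | "w \<in> ?A - {u, u'}" using w by auto
    then show "z \<in> take n ` (?A - {u, u'})"
      using w assms by cases (metis imageI)+
  qed
  then have "card (factors_of_length x n) \<le> card (take n ` (?A - {u, u'}))"
    unfolding im[symmetric] by (intro card_mono) (auto simp: finite_factors)
  also have "\<dots> \<le> card (?A - {u, u'})"
    by (intro card_image_le) (simp add: finite_factors)
  also have "\<dots> = card ?A - 2"
    using assms by (subst card_Diff_subset) auto
  finally show False by (simp add: card_factors)
qed

text \<open>Otherwise each of the two words could lose one extension and truncation would still be
  onto.\<close>

lemma right_special_unique:
  assumes "1 \<le> i" "1 \<le> i'" "1 \<le> k" "1 \<le> k'"
    and "fac n i = fac n i'" "fac (Suc n) i \<noteq> fac (Suc n) i'"
    and "fac n k = fac n k'" "fac (Suc n) k \<noteq> fac (Suc n) k'"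
  shows "fac n i = fac n k"
proof (rule ccontr)
  assume ne: "fac n i \<noteq> fac n k"
  show False
    by (rule one_redundant_factor[of "fac (Suc n) i" n "fac (Suc n) k" "fac (Suc n) i'" "fac (Suc n) k'"])
      (use assms ne in \<open>auto simp: fac_in take_factor_at factor_at_Suc_eq_iff\<close>)
qed

text \<open>Given a third extension, two of the three would be redundant at once.\<close>

lemma right_extensions:
  assumes "1 \<le> i" "1 \<le> i'" "1 \<le> k"
    and "fac n i = fac n i'" "fac (Suc n) i \<noteq> fac (Suc n) i'" "fac n k = fac n i"
  shows "fac (Suc n) k = fac (Suc n) i \<or> fac (Suc n) k = fac (Suc n) i'"
proof (rule ccontr)
  assume ne: "\<not> ?thesis"
  show False
    by (rule one_redundant_factor[of "fac (Suc n) k" n "fac (Suc n) i" "fac (Suc n) i'" "fac (Suc n) i'"])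
      (use assms ne in \<open>auto simp: fac_in take_factor_at\<close>)
qed

section \<open>Position of the first repeated factor\<close>

lemma ex_repeat: "\<exists>j\<le>n + 2. \<exists>i. 1 \<le> i \<and> i < j \<and> fac n i = fac n j"
proof -
  have "\<not> inj_on (fac n) {1..n + 2}"
  proof
    assume "inj_on (fac n) {1..n + 2}"
    then have "card (fac n ` {1..n + 2}) = n + 2" by (simp add: card_image)
    moreover have "card (fac n ` {1..n + 2}) \<le> card (factors_of_length x n)"
      by (intro card_mono finite_factors) (auto simp: fac_in)
    ultimately show False by (simp add: card_factors)
  qed
  then obtain i j where "i \<in> {1..n + 2}" "j \<in> {1..n + 2}" "i \<noteq> j" "fac n i = fac n j"
    by (auto simp: inj_on_def)
  then show ?thesis by (cases i j rule: linorder_cases) (auto intro!: exI)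
qed

lemma first_repeat_repeats: "\<exists>i. 1 \<le> i \<and> i < fr n \<and> fac n i = fac n (fr n)"
proof -
  have "\<exists>j i. 1 \<le> i \<and> i < j \<and> fac n i = fac n j" using ex_repeat[of n] by blast
  then show ?thesis unfolding first_repeat_def by (rule LeastI_ex)
qed

lemma first_repeat_le: "1 \<le> i \<Longrightarrow> i < j \<Longrightarrow> fac n i = fac n j \<Longrightarrow> fr n \<le> j"
  unfolding first_repeat_def by (rule Least_le) blast

lemma first_repeat_bound: "fr n \<le> n + 2"
  using ex_repeat[of n] first_repeat_le order_trans by blast

lemma first_repeat_ge: "2 \<le> fr n"
  using first_repeat_repeats[of n] by auto

lemma inj_below_first_repeat: "inj_on (fac n) {1..<fr n}"
proof (rule linorder_inj_onI)
  fix i j assume "i < j" "i \<in> {1..<fr n}" "j \<in> {1..<fr n}"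
  then show "fac n i \<noteq> fac n j" using first_repeat_le[of i j n] by auto
qed auto

lemma first_repeat_mono_Suc: "fr n \<le> fr (Suc n)"
  using first_repeat_repeats[of "Suc n"] first_repeat_le factor_at_Suc_eq_iff by blast

text \<open>A factor of length \<open>n\<close> that ends at \<open>m\<close> starts at
  \<open>m + 1 - n\<close>, so the two minima differ by \<open>n - 1\<close>.\<close>

lemma rfun_eq: "rfun n x = n + (fr n - 1)"
  unfolding rfun_def
proof (rule Least_equality, goal_cases)
  case 1
  obtain i where i: "1 \<le> i" "i < fr n" "fac n i = fac n (fr n)"
    using first_repeat_repeats by blast
  have eq: "n + (fr n - 1) + 1 = fr n + n" using first_repeat_ge[of n] by auto
  show ?case using i first_repeat_ge[of n] unfolding factor_at_def eq
    by (intro conjI exI[of _ i]) auto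
next
  case (2 m)
  then obtain i where i: "1 \<le> i" "i + n \<le> m" "map x [i..<i + n] = map x [m + 1 - n..<m + 1]"
    by blast
  have "m + 1 = (m + 1 - n) + n" using i by simp
  then have "fac n i = fac n (m + 1 - n)" using i unfolding factor_at_def by metis
  then have "fr n \<le> m + 1 - n" using i by (intro first_repeat_le[of i]) auto
  then show ?case using i by auto
qed

text \<open>When the repetition of length \<open>n\<close> does not extend, the right special factor of length
  \<open>n\<close> has been left along both of its edges in the Rauzy graph. Hence at the first repeated
  edge the set of visited edges is closed under continuation, that is, it is everything.\<close>

lemma first_repeat_jump:
  assumes "fr (Suc n) \<noteq> fr n"
  shows "fr (Suc n) = n + 3"
proof -
  have less: "fr n < fr (Suc n)" using assms first_repeat_mono_Suc[of n] by simp
  obtain i where i: "1 \<le> i" "i < fr n" "fac n i = fac n (fr n)"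
    using first_repeat_repeats by blast
  obtain i' where i': "1 \<le> i'" "i' < fr (Suc n)" "fac (Suc n) i' = fac (Suc n) (fr (Suc n))"
    using first_repeat_repeats by blast
  have ne: "fac (Suc n) i \<noteq> fac (Suc n) (fr n)"
    using first_repeat_le[of i "fr n" "Suc n"] i less by auto
  let ?T = "fac (Suc n) ` {1..<fr (Suc n)}"
  have T: "fac (Suc n) k \<in> ?T" if "1 \<le> k" for k
    using that
  proof (induction k rule: nat_induct_at_least)
    case base
    then show ?case using first_repeat_ge[of "Suc n"] by auto
  next
    case (Suc k)
    then obtain l where l: "1 \<le> l" "l < fr (Suc n)" "fac (Suc n) k = fac (Suc n) l" by auto
    have tail: "fac n (Suc k) = fac n (Suc l)" using l by (intro factor_at_Suc_tail)
    \<comment> \<open>The successor of a visited edge is visited: either it still precedes the first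
      repeated edge, or it is that edge and was visited at \<open>i'\<close>.\<close>
    have lT: "fac (Suc n) (Suc l) \<in> ?T"
    proof (cases "Suc l = fr (Suc n)")
      case True
      then show ?thesis using i' by (auto simp flip: i'(3))
    qed (use l in auto)
    show ?case
    \<comment> \<open>The right special vertex has only two outgoing edges, both visited, at
      \<open>i\<close> and at \<open>fr n\<close>; any other vertex has only one.\<close>
    proof (cases "fac n (Suc k) = fac n i")
      case True
      then have "fac (Suc n) (Suc k) = fac (Suc n) i \<or> fac (Suc n) (Suc k) = fac (Suc n) (fr n)"
        using i ne by (intro right_extensions) auto
      then show ?thesis using i less by auto
    next
      case False
      then have "fac (Suc n) (Suc k) = fac (Suc n) (Suc l)"
        using right_special_unique[of "Suc k" "Suc l" i "fr n" n] tail i ne by auto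
      then show ?thesis using lT by simp
    qed
  qed
  then have "factors_of_length x (Suc n) = ?T"
    by (auto simp: factors_of_length_eq)
  then have "Suc n + 1 = card ?T" using card_factors[of "Suc n"] by simp
  also have "\<dots> = fr (Suc n) - 1"
    using inj_below_first_repeat by (simp add: card_image)
  finally show ?thesis by simp
qed

text \<open>Periodicity carries every factor of length \<open>c\<close> back to a start below
  \<open>c\<close>, which leaves at most \<open>c - 1\<close> of them instead of
  \<open>c + 1\<close>.\<close>

lemma not_eventually_periodic:
  assumes "1 \<le> i" "i < c" "\<And>t. x (i + t) = x (c + t)"
  shows False
proof -
  have "fac c k \<in> fac c ` {1..<c}" if "1 \<le> k" for k
    using that
  proof (induction k rule: less_induct)
    case (less k)
    show ?case
    proof (cases "k < c")
      case True
      then show ?thesis using less by auto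
    next
      case False
      have "fac c (i + (k - c)) = fac c k"
        unfolding factor_at_eq_iff
        using assms(3)[of "k - c + t" for t] False by (auto simp: algebra_simps)
      moreover have "fac c (i + (k - c)) \<in> fac c ` {1..<c}"
        using False assms by (intro less.IH) auto
      ultimately show ?thesis by simp
    qed
  qed
  then have "factors_of_length x c \<subseteq> fac c ` {1..<c}"
    by (auto simp: factors_of_length_eq)
  then have "card (factors_of_length x c) \<le> card (fac c ` {1..<c})"
    by (intro card_mono) auto
  also have "\<dots> \<le> c - 1" using card_image_le[of "{1..<c}" "fac c"] by simp
  finally show False by (simp add: card_factors)
qed

text \<open>Were \<open>fr\<close> constant from \<open>N\<close> on, the factors of all larger
  lengths at \<open>fr N\<close> would have occurred before at one and the same \<open>i\<close>, by
  injectivity below \<open>fr N\<close>, and \<open>x\<close> would be eventually periodic.\<close>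

lemma ex_jump_ge: "\<exists>n\<ge>N. fr (Suc n) \<noteq> fr n"
proof (rule ccontr)
  assume "\<not> ?thesis"
  then have step: "fr (Suc n) = fr n" if "n \<ge> N" for n using that by auto
  have const: "fr n = fr N" if "n \<ge> N" for n
    using that by (induction n rule: nat_induct_at_least) (auto simp: step)
  obtain i where i: "1 \<le> i" "i < fr N" "fac N i = fac N (fr N)"
    using first_repeat_repeats by blast
  have "x (i + t) = x (fr N + t)" for t
  proof -
    let ?n = "N + Suc t"
    obtain k where k: "1 \<le> k" "k < fr N" "fac ?n k = fac ?n (fr N)"
      using first_repeat_repeats[of ?n] const[of ?n] by auto
    then have "fac N k = fac N (fr N)" by (auto simp: factor_at_eq_iff)
    then have "k = i"
      using i k inj_onD[OF inj_below_first_repeat[of N], of k i] by auto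
    then show ?thesis using k(3) by (auto simp: factor_at_eq_iff)
  qed
  then show False using not_eventually_periodic i by blast
qed

text \<open>Between consecutive jumps \<open>u < v\<close> the first repetition stays at the position
  \<open>u + 3\<close> that was forced by the jump \<open>u\<close>.\<close>

lemma jump_before:
  assumes "fr (Suc v) \<noteq> fr v" "u\<^sub>0 < v" "fr (Suc u\<^sub>0) \<noteq> fr u\<^sub>0"
  shows "\<exists>u<v. fr (Suc u) \<noteq> fr u \<and> fr v = u + 3"
proof -
  let ?U = "{u. u < v \<and> fr (Suc u) \<noteq> fr u}"
  define u where "u = Max ?U"
  have U: "finite ?U" "?U \<noteq> {}" using assms by auto
  have u: "u < v" "fr (Suc u) \<noteq> fr u" using Max_in[OF U] by (auto simp: u_def)
  have "fr n = u + 3" if "Suc u \<le> n" "n \<le> v" for n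
    using that
  proof (induction n rule: nat_induct_at_least)
    case base
    show ?case using first_repeat_jump u by blast
  next
    case (Suc n)
    have "n \<notin> ?U" using Max_ge[OF U(1), of n] Suc.hyps unfolding u_def by linarith
    then show ?case using Suc by auto
  qed
  then show ?thesis using u by (intro exI[of _ u]) auto
qed

section \<open>Bounded runs of a single letter\<close>

lemma not_eventually_constant: "\<exists>k\<ge>T. x k \<noteq> d"
proof (rule ccontr)
  assume "\<not> ?thesis"
  then show False using not_eventually_periodic[of "Suc T" "Suc (Suc T)"] by auto
qed

text \<open>There are only two factors of length 1.\<close>

lemma two_letters:
  assumes "1 \<le> i" "1 \<le> k" "1 \<le> l" "x i \<noteq> x l" "x k \<noteq> x l"
  shows "x i = x k"
proof (rule ccontr)
  assume "x i \<noteq> x k"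
  then have "card {[x i], [x k], [x l]} = 3" using assms by simp
  moreover have "{[x i], [x k], [x l]} \<subseteq> factors_of_length x 1"
    using assms fac_in[of _ 1] by (auto simp: factor_at_def)
  then have "card {[x i], [x k], [x l]} \<le> card (factors_of_length x 1)"
    using card_mono finite_factors by blast
  ultimately show False by (simp add: card_factors)
qed

text \<open>If arbitrarily long runs of \<open>d\<close> occurred, then every power of \<open>d\<close> would be the right
  special factor of its length; but then a maximal run of length \<open>k\<close> after another letter can
  never be followed by a longer one.\<close>

lemma bounded_runs: "\<exists>K. \<forall>n\<ge>1. \<exists>k\<in>{n..<n + K}. x k \<noteq> d"
proof (rule ccontr)
  assume "\<not> ?thesis"
  then have runs: "\<exists>n\<ge>1. \<forall>k\<in>{n..<n + K}. x k = d" for K by blast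
  obtain j where j: "j \<ge> 1" "x j \<noteq> d" using not_eventually_constant by blast
  define e where "e = (LEAST l. l > j \<and> x l \<noteq> d)"
  have "\<exists>l. l > j \<and> x l \<noteq> d" using not_eventually_constant[of "Suc j" d] by (auto simp: Suc_le_eq)
  then have "e > j \<and> x e \<noteq> d" unfolding e_def by (rule LeastI_ex)
  then have e: "e > j" "x e \<noteq> d" by auto
  have before_e: "x l = d" if "l > j" "l < e" for l
    using that not_less_Least[of l "\<lambda>l. l > j \<and> x l \<noteq> d"] by (auto simp: e_def)
  \<comment> \<open>Exactly \<open>k\<close> letters \<open>d\<close> follow position
    \<open>j\<close>; \<open>t\<close> is the first start of \<open>k + 1\<close> of them at or
    after \<open>j\<close>, so \<open>x (t - 1) \<noteq> d\<close>.\<close>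
  define k where "k = e - j - 1"
  have k: "e = j + k + 1" using e by (simp add: k_def)
  define t where "t = (LEAST t. t \<ge> j \<and> (\<forall>l\<le>k. x (t + l) = d))"
  have "\<exists>t. t \<ge> j \<and> (\<forall>l\<le>k. x (t + l) = d)"
  proof -
    obtain n where n: "n \<ge> 1" "\<forall>i\<in>{n..<n + (j + k + 1)}. x i = d" using runs by blast
    then show ?thesis by (intro exI[of _ "n + j"]) auto
  qed
  then have "t \<ge> j \<and> (\<forall>l\<le>k. x (t + l) = d)" unfolding t_def by (rule LeastI_ex)
  then have t: "t \<ge> j" "\<forall>l\<le>k. x (t + l) = d" by auto
  have tj: "t > j" using t j by (metis add.right_neutral le0 le_neq_implies_less)
  have xt: "x (t - 1) \<noteq> d"
  proof
    assume xd: "x (t - 1) = d"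
    have "x (t - 1 + l) = d" if "l \<le> k" for l
      using that xd t tj by (cases l) auto
    then have "t \<le> t - 1" unfolding t_def using tj
      by (intro Least_le) (auto simp: t_def)
    then show False using tj by simp
  qed
  obtain n where n: "n \<ge> 1" "\<forall>i\<in>{n..<n + (k + 2)}. x i = d" using runs by blast
  define e' where "e' = (LEAST l. l \<ge> n \<and> x l \<noteq> d)"
  have "\<exists>l. l \<ge> n \<and> x l \<noteq> d" using not_eventually_constant[of n d] by auto
  then have "e' \<ge> n \<and> x e' \<noteq> d" unfolding e'_def by (rule LeastI_ex)
  then have e': "e' \<ge> n" "x e' \<noteq> d" by auto
  have before_e': "x l = d" if "l \<ge> n" "l < e'" for l
    using that not_less_Least[of l "\<lambda>l. l \<ge> n \<and> x l \<noteq> d"] by (auto simp: e'_def)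
  have "e' \<notin> {n..<n + (k + 2)}" using n(2) e'(2) by blast
  then have e'_far: "e' \<ge> n + k + 2" using e'(1) by simp
  have xj: "x j = x (t - 1)"
    using two_letters[of j "t - 1" n] j tj n xt by auto
  have shift: "x (j + l) = x (t - 1 + l)" if "l \<le> k" for l
    using that xj t tj before_e[of "j + l"] k by (cases l) auto
  \<comment> \<open>Both words are right special. The letter \<open>x j\<close> followed by
    \<open>k\<close> letters \<open>d\<close> continues with \<open>x e \<noteq> d\<close> at
    \<open>j\<close> and with \<open>d\<close> at \<open>t - 1\<close>; the word of
    \<open>k + 1\<close> letters \<open>d\<close> continues with \<open>d\<close> at
    \<open>n\<close> and with \<open>x e' \<noteq> d\<close> at the end of its run. Uniqueness then
    forces \<open>x j = d\<close>.\<close>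
  have "fac (Suc k) j = fac (Suc k) n"
  proof (rule right_special_unique[of j "t - 1" n "e' - k - 1"])
    show "fac (Suc k) j = fac (Suc k) (t - 1)"
      using shift by (auto simp: factor_at_eq_iff)
    have "x (t - 1 + Suc k) = d" using t tj by auto
    then show "fac (Suc (Suc k)) j \<noteq> fac (Suc (Suc k)) (t - 1)"
      using e k by (auto simp: factor_at_Suc_eq_iff[of _ "Suc k"])
    have "x (n + l) = x (e' - k - 1 + l)" if "l \<le> k" for l
      using that n e'_far before_e'[of "e' - k - 1 + l"] by auto
    then show "fac (Suc k) n = fac (Suc k) (e' - k - 1)"
      by (auto simp: factor_at_eq_iff)
    have "x (n + Suc k) = d" "e' - k - 1 + Suc k = e'" using n e'_far by auto
    then show "fac (Suc (Suc k)) n \<noteq> fac (Suc (Suc k)) (e' - k - 1)"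
      using e' by (auto simp: factor_at_Suc_eq_iff[of _ "Suc k"])
  qed (use j tj n e'_far in auto)
  then have "x j = x n" by (auto simp: factor_at_eq_iff)
  then show False using n j by auto
qed

end

section \<open>Expansions in base \<open>b\<close>\<close>

definition expansion :: "nat \<Rightarrow> (nat \<Rightarrow> nat) \<Rightarrow> real" where
  "expansion b f = (\<Sum>k. real (f (Suc k)) / real b ^ Suc k)"

text \<open>The integer with base \<open>b\<close> digits \<open>f 1\<close>, ...,
  \<open>f n\<close>, that is, \<open>b ^ n\<close> times a partial sum of
  \<open>expansion\<close>.\<close>

fun prefix_value :: "nat \<Rightarrow> (nat \<Rightarrow> nat) \<Rightarrow> nat \<Rightarrow> nat" where
  "prefix_value b f 0 = 0"
| "prefix_value b f (Suc n) = b * prefix_value b f n + f (Suc n)"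

lemma prefix_value_cong:
  "(\<And>k. 1 \<le> k \<Longrightarrow> k \<le> n \<Longrightarrow> f k = g k) \<Longrightarrow> prefix_value b f n = prefix_value b g n"
  by (induction n) auto

lemma prefix_value_add:
  "prefix_value b f (n + m) = b ^ m * prefix_value b f n + prefix_value b (\<lambda>k. f (k + n)) m"
  by (induction m) (auto simp: algebra_simps)

locale digits =
  fixes b :: nat and f :: "nat \<Rightarrow> nat"
  assumes base: "b \<ge> 2" and digit: "\<And>k. k \<ge> 1 \<Longrightarrow> f k < b"
begin

lemma digits_shift: "digits b (\<lambda>k. f (k + n))"
  by unfold_locales (use base digit in auto)

lemma prefix_value_less: "prefix_value b f n < b ^ n"
proof (induction n)
  case (Suc n)
  have "prefix_value b f (Suc n) < b * (prefix_value b f n + 1)"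
    using digit[of "Suc n"] by simp
  also have "\<dots> \<le> b * b ^ n" using Suc by (intro mult_left_mono) auto
  finally show ?case by simp
qed auto

text \<open>A digit of at most \<open>b - 2\<close> opens a gap of 2, which later digits cannot
  close because \<open>b + 1 \<le> 2 * b\<close>.\<close>

lemma prefix_value_less_less:
  assumes "k \<in> {1..n}" "f k \<noteq> b - 1"
  shows "prefix_value b f n + 2 \<le> b ^ n"
  using assms
proof (induction n)
  case (Suc n)
  show ?case
  proof (cases "k = Suc n")
    case True
    then have "prefix_value b f (Suc n) + 2 \<le> b * (prefix_value b f n + 1)"
      using digit[of "Suc n"] Suc.prems by simp
    also have "\<dots> \<le> b * b ^ n"
      using prefix_value_less[of n] by (intro mult_left_mono) auto
    finally show ?thesis by simp
  next
    case False
    have "prefix_value b f (Suc n) + 2 \<le> b * (prefix_value b f n + 2)"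
      using digit[of "Suc n"] base by (simp add: algebra_simps)
    also have "\<dots> \<le> b * b ^ n" using Suc False by (intro mult_left_mono) auto
    finally show ?thesis by simp
  qed
qed auto

lemma prefix_value_pos:
  assumes "k \<in> {1..n}" "f k \<noteq> 0"
  shows "1 \<le> prefix_value b f n"
  using assms
proof (induction n)
  case (Suc n)
  then show ?case using base by (cases "k = Suc n") (auto simp: Suc_le_eq)
qed auto

lemma geometric: "(\<lambda>k. (real b - 1) / real b ^ Suc k) sums 1"
proof -
  have "(\<lambda>k. (real b - 1) / real b * (1 / real b) ^ k) sums ((real b - 1) / real b * (1 / (1 - 1 / real b)))"
    using base by (intro sums_mult geometric_sums) auto
  moreover have "(real b - 1) / real b * (1 / (1 - 1 / real b)) = 1"
    using base by (simp add: field_simps)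
  ultimately have "(\<lambda>k. (real b - 1) / real b * (1 / real b) ^ k) sums 1" by (simp only:)
  then show ?thesis by (simp add: power_divide)
qed

lemma term_le: "real (f (Suc k)) / real b ^ Suc k \<le> (real b - 1) / real b ^ Suc k"
  using digit[of "Suc k"] base by (intro divide_right_mono) auto

lemma summable_expansion: "summable (\<lambda>k. real (f (Suc k)) / real b ^ Suc k)"
  by (rule summable_comparison_test'[OF sums_summable[OF geometric], of 0])
    (use term_le in auto)

lemma expansion_nonneg: "0 \<le> expansion b f"
  unfolding expansion_def by (intro suminf_nonneg summable_expansion) auto

lemma expansion_le_1: "expansion b f \<le> 1"
proof -
  have "expansion b f \<le> (\<Sum>k. (real b - 1) / real b ^ Suc k)"
    unfolding expansion_def
    by (intro suminf_le summable_expansion sums_summable[OF geometric] term_le)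
  then show ?thesis using sums_unique[OF geometric] by simp
qed

lemma expansion_Suc: "real b * expansion b f = real (f 1) + expansion b (\<lambda>k. f (Suc k))"
proof -
  interpret s: digits b "\<lambda>k. f (Suc k)" using digits_shift[of 1] by simp
  have "expansion b f = real (f 1) / real b + (\<Sum>k. real (f (Suc (Suc k))) / real b ^ Suc (Suc k))"
    unfolding expansion_def using suminf_split_head[OF summable_expansion] by simp
  also have "(\<Sum>k. real (f (Suc (Suc k))) / real b ^ Suc (Suc k))
      = (\<Sum>k. (real (f (Suc (Suc k))) / real b ^ Suc k) / real b)"
    by (simp add: field_simps)
  also have "\<dots> = expansion b (\<lambda>k. f (Suc k)) / real b"
    unfolding expansion_def by (intro suminf_divide s.summable_expansion)
  finally show ?thesis using base by (simp add: field_simps)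
qed

lemma expansion_split:
  "real b ^ n * expansion b f = real (prefix_value b f n) + expansion b (\<lambda>k. f (k + n))"
proof (induction n)
  case (Suc n)
  interpret s: digits b "\<lambda>k. f (k + n)" by (rule digits_shift)
  have "real b ^ Suc n * expansion b f = real b * (real b ^ n * expansion b f)" by simp
  also have "\<dots> = real b * real (prefix_value b f n) + real b * expansion b (\<lambda>k. f (k + n))"
    by (simp only: Suc distrib_left)
  finally show ?case using s.expansion_Suc by simp
qed simp

lemma expansion_lower: "real (prefix_value b f n) \<le> real b ^ n * expansion b f"
  using expansion_split[of n] digits.expansion_nonneg[OF digits_shift[of n]] by simp

lemma expansion_upper: "real b ^ n * expansion b f \<le> real (prefix_value b f n) + 1"
  using expansion_split[of n] digits.expansion_le_1[OF digits_shift[of n]] by simp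

end

text \<open>Both numbers lie in the closed interval of length \<open>1 / real b ^ n\<close> fixed by
  the common prefix.\<close>

lemma expansion_close:
  assumes "digits b f" "digits b g" and eq: "\<And>k. 1 \<le> k \<Longrightarrow> k \<le> n \<Longrightarrow> f k = g k"
  shows "\<bar>expansion b f - expansion b g\<bar> \<le> 1 / real b ^ n"
proof -
  have "prefix_value b f n = prefix_value b g n" by (intro prefix_value_cong eq)
  then have "\<bar>real b ^ n * expansion b f - real b ^ n * expansion b g\<bar> \<le> 1"
    using digits.expansion_lower[OF assms(1), of n] digits.expansion_upper[OF assms(1), of n]
      digits.expansion_lower[OF assms(2), of n] digits.expansion_upper[OF assms(2), of n] by linarith
  then have "real b ^ n * \<bar>expansion b f - expansion b g\<bar> \<le> 1"
    by (simp add: abs_mult flip: right_diff_distrib)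
  moreover have "0 < real b ^ n" using digits.base[OF assms(1)] by simp
  ultimately show ?thesis by (simp add: field_simps)
qed

text \<open>The bounded runs of extreme digits exclude that the difference in the digit \<open>m + 1\<close> is
  cancelled by carries.\<close>

lemma expansion_apart:
  assumes f: "digits b f" and g: "digits b g"
    and eq: "\<And>k. 1 \<le> k \<Longrightarrow> k \<le> m \<Longrightarrow> f k = g k" and ne: "f (Suc m) \<noteq> g (Suc m)"
    and not_max: "\<exists>k\<in>{1..K}. f (k + Suc m) \<noteq> b - 1"
    and not_zero: "\<exists>k\<in>{1..K}. f (k + Suc m) \<noteq> 0"
  shows "1 / real b ^ (Suc m + K) \<le> \<bar>expansion b f - expansion b g\<bar>"
proof -
  let ?N = "Suc m + K"
  let ?P = "prefix_value b"
  interpret fs: digits b "\<lambda>k. f (k + Suc m)" by (rule digits.digits_shift[OF f])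
  \<comment> \<open>Only the digits of \<open>f\<close> are controlled: \<open>upp\<close> serves
    when \<open>f\<close> has the smaller digit at \<open>Suc m\<close>, \<open>low\<close> when it
    has the larger. Either way the prefixes of length \<open>?N\<close> differ by at least 2, of
    which tails in [0, 1] use up at most 1.\<close>
  have low: "1 \<le> ?P (\<lambda>k. f (k + Suc m)) K" using not_zero fs.prefix_value_pos by blast
  have upp: "?P (\<lambda>k. f (k + Suc m)) K + 2 \<le> b ^ K" using not_max fs.prefix_value_less_less by blast
  have pm: "?P f m = ?P g m" by (intro prefix_value_cong eq)
  note fN = prefix_value_add[of b f "Suc m" K]
  note gN = prefix_value_add[of b g "Suc m" K]
  have gs: "?P (\<lambda>k. g (k + Suc m)) K < b ^ K"
    by (intro digits.prefix_value_less digits.digits_shift g)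
  consider "Suc (?P f (Suc m)) \<le> ?P g (Suc m)" | "Suc (?P g (Suc m)) \<le> ?P f (Suc m)"
    using pm ne by force
  then have "1 \<le> \<bar>real b ^ ?N * expansion b f - real b ^ ?N * expansion b g\<bar>"
  proof cases
    case 1
    have "b ^ K * Suc (?P f (Suc m)) \<le> b ^ K * ?P g (Suc m)" using 1 by (intro mult_left_mono) auto
    then have "?P f ?N + 2 \<le> ?P g ?N" unfolding fN gN using upp by (simp add: algebra_simps)
    then have "real (?P f ?N) + 2 \<le> real (?P g ?N)" by linarith
    then show ?thesis
      using digits.expansion_upper[OF f, of ?N] digits.expansion_lower[OF g, of ?N] by linarith
  next
    case 2
    have "b ^ K * Suc (?P g (Suc m)) \<le> b ^ K * ?P f (Suc m)" using 2 by (intro mult_left_mono) auto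
    then have "?P g ?N + 2 \<le> ?P f ?N" unfolding fN gN using low gs by (simp add: algebra_simps)
    then have "real (?P g ?N) + 2 \<le> real (?P f ?N)" by linarith
    then show ?thesis
      using digits.expansion_lower[OF f, of ?N] digits.expansion_upper[OF g, of ?N] by linarith
  qed
  then have "1 \<le> real b ^ ?N * \<bar>expansion b f - expansion b g\<bar>"
    by (simp add: abs_mult flip: right_diff_distrib)
  moreover have "0 < real b ^ ?N" using fs.base by simp
  ultimately show ?thesis by (simp add: field_simps)
qed

section \<open>Rational numbers and their denominators\<close>

definition denom :: "rat \<Rightarrow> real" where
  "denom r = real_of_int (snd (quotient_of r))"

lemma denom_ge_1: "1 \<le> denom r"
  using quotient_of_denom_pos'[of r] by (simp add: denom_def)

lemma of_rat_eq_fst_div_denom: "of_rat r = real_of_int (fst (quotient_of r)) / denom r"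
  using quotient_of_div[of r "fst (quotient_of r)" "snd (quotient_of r)"]
  by (metis denom_def of_rat_divide of_rat_of_int_eq prod.collapse)

text \<open>A reduced denominator divides every other denominator of the same number.\<close>

lemma denom_le:
  assumes "N > 0" "real N * y = of_int P"
  shows "\<exists>r. of_rat r = y \<and> denom r \<le> real N"
proof (intro exI conjI)
  let ?r = "of_int P / of_nat N :: rat"
  show y: "of_rat ?r = y" using assms by (simp add: of_rat_divide field_simps)
  let ?p = "fst (quotient_of ?r)" and ?q = "snd (quotient_of ?r)"
  have q: "?q > 0" by (rule quotient_of_denom_pos')
  have "?r = of_int ?p / of_int ?q" by (rule quotient_of_div) simp
  then have "(of_int (?p * int N) :: rat) = of_int (P * ?q)"
    using q assms(1) by (simp add: field_simps)
  then have "?p * int N = P * ?q" by (simp only: of_int_eq_iff)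
  then have "?q dvd ?p * int N" by simp
  moreover have "coprime ?p ?q" by (rule quotient_of_coprime) simp
  ultimately have "?q dvd int N" using coprime_dvd_mult_right_iff coprime_commute by blast
  then have "?q \<le> int N" using assms(1) by (intro zdvd_imp_le) auto
  then show "denom ?r \<le> real N" by (simp add: denom_def)
qed

text \<open>Over the common denominator, the numerator of the difference is a nonzero
  integer.\<close>

lemma rat_distance:
  assumes "r \<noteq> s"
  shows "1 / (denom r * denom s) \<le> \<bar>of_rat r - of_rat s :: real\<bar>"
proof -
  let ?d = "fst (quotient_of r) * snd (quotient_of s) - fst (quotient_of s) * snd (quotient_of r)"
  have pos: "denom r > 0" "denom s > 0" using denom_ge_1[of r] denom_ge_1[of s] by linarith+
  have eq: "of_rat r - of_rat s = real_of_int ?d / (denom r * denom s)"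
    using pos unfolding of_rat_eq_fst_div_denom by (simp add: field_simps denom_def)
  have "of_rat r - of_rat s \<noteq> (0 :: real)" using assms by simp
  then have "?d \<noteq> 0" unfolding eq by (metis div_0 of_int_0)
  then have "1 \<le> \<bar>real_of_int ?d\<bar>" by linarith
  then show ?thesis unfolding eq using pos by (simp add: abs_mult divide_right_mono)
qed

text \<open>Bounds on the denominator and on the value also bound the numerator.\<close>

lemma finite_bounded_denom:
  fixes \<xi> B :: real
  shows "finite {r. \<bar>\<xi> - of_rat r\<bar> \<le> 1 \<and> denom r \<le> B}"
proof -
  let ?S = "{r. \<bar>\<xi> - of_rat r\<bar> \<le> 1 \<and> denom r \<le> B}"
  let ?M = "\<lceil>(\<bar>\<xi>\<bar> + 1) * B\<rceil>"
  have "quotient_of ` ?S \<subseteq> {-?M..?M} \<times> {0..\<lceil>B\<rceil>}"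
  proof
    fix z assume "z \<in> quotient_of ` ?S"
    then obtain r where r: "z = quotient_of r" "\<bar>\<xi> - of_rat r\<bar> \<le> 1" "denom r \<le> B" by auto
    have d: "denom r \<ge> 1" by (rule denom_ge_1)
    have "real_of_int (fst z) = of_rat r * denom r"
      unfolding of_rat_eq_fst_div_denom r(1) using d by simp
    then have "\<bar>real_of_int (fst z)\<bar> = \<bar>of_rat r\<bar> * denom r" using d by (simp add: abs_mult)
    also have "\<dots> \<le> (\<bar>\<xi>\<bar> + 1) * B" using r(2,3) d by (intro mult_mono) linarith+
    finally have "fst z \<in> {-?M..?M}" by (auto simp: le_ceiling_iff) linarith+
    moreover have "snd z \<in> {0..\<lceil>B\<rceil>}" using r d unfolding denom_def by (auto simp: le_ceiling_iff)
    ultimately show "z \<in> {-?M..?M} \<times> {0..\<lceil>B\<rceil>}" by (cases z) auto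
  qed
  then have "finite (quotient_of ` ?S)" by (rule finite_subset) auto
  moreover have "inj_on quotient_of ?S" by (metis inj_onI quotient_of_inject)
  ultimately show ?thesis using finite_imageD by blast
qed

section \<open>Approximation by eventually periodic expansions\<close>

lemma expansion_cong: "(\<And>k. 1 \<le> k \<Longrightarrow> f k = g k) \<Longrightarrow> expansion b f = expansion b g"
  by (simp add: expansion_def)

text \<open>The shifts by \<open>s\<close> and by \<open>s + p\<close> have the same tail, which
  cancels when the two splittings are subtracted; so \<open>b ^ (s + p) - b ^ s\<close> is a
  denominator.\<close>

lemma (in digits) denom_eventually_periodic:
  assumes "0 < p" and per: "\<And>k. s < k \<Longrightarrow> f (k + p) = f k"
  shows "\<exists>y. of_rat y = expansion b f \<and> denom y \<le> real b ^ (s + p)"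
proof -
  have "expansion b (\<lambda>k. f (k + (s + p))) = expansion b (\<lambda>k. f (k + s))"
  proof (rule expansion_cong)
    fix k :: nat assume "1 \<le> k"
    then show "f (k + (s + p)) = f (k + s)" using per[of "k + s"] by (simp add: algebra_simps)
  qed
  then have "(real b ^ (s + p) - real b ^ s) * expansion b f
      = of_int (int (prefix_value b f (s + p)) - int (prefix_value b f s))"
    using expansion_split[of "s + p"] expansion_split[of s] by (simp add: left_diff_distrib)
  moreover have less: "b ^ s < b ^ (s + p)" using base assms by simp
  ultimately have "real (b ^ (s + p) - b ^ s) * expansion b f
      = of_int (int (prefix_value b f (s + p)) - int (prefix_value b f s))"
    by (simp add: of_nat_diff)
  then obtain y where "of_rat y = expansion b f" "denom y \<le> real (b ^ (s + p) - b ^ s)"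
    using denom_le less by (metis zero_less_diff)
  moreover have "real (b ^ (s + p) - b ^ s) \<le> real b ^ (s + p)" by (simp flip: of_nat_power)
  ultimately show ?thesis by (meson order_trans)
qed

locale sturmian_number = digits b x + sturmian_word x for b x
begin

abbreviation \<xi> where "\<xi> \<equiv> expansion b x"

lemma bounded_extreme_runs:
  "\<exists>K. \<forall>n\<ge>1. (\<exists>k\<in>{n..<n + K}. x k \<noteq> b - 1) \<and> (\<exists>k\<in>{n..<n + K}. x k \<noteq> 0)"
proof -
  obtain K L where "\<forall>n\<ge>1. \<exists>k\<in>{n..<n + K}. x k \<noteq> b - 1" "\<forall>n\<ge>1. \<exists>k\<in>{n..<n + L}. x k \<noteq> 0"
    using bounded_runs by metis
  moreover have "{n..<n + K} \<subseteq> {n..<n + (K + L)}" "{n..<n + L} \<subseteq> {n..<n + (K + L)}" for n by auto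
  ultimately show ?thesis by (intro exI[of _ "K + L"]) blast
qed

text \<open>The approximant prolongs the repetition that ends at \<open>rfun n x\<close> periodically.\<close>

lemma approximants:
  "\<exists>K. \<forall>n. \<exists>y. denom y \<le> real b ^ (fr n - 1) \<and> \<bar>\<xi> - of_rat y\<bar> \<le> 1 / real b ^ rfun n x \<and>
     (fr (Suc n) \<noteq> fr n \<longrightarrow> 1 / real b ^ (rfun n x + K) \<le> \<bar>\<xi> - of_rat y\<bar>)"
proof -
  obtain K where K: "\<forall>n\<ge>1. (\<exists>k\<in>{n..<n + K}. x k \<noteq> b - 1) \<and> (\<exists>k\<in>{n..<n + K}. x k \<noteq> 0)"
    using bounded_extreme_runs by blast
  have "\<exists>y. denom y \<le> real b ^ (fr n - 1) \<and> \<bar>\<xi> - of_rat y\<bar> \<le> 1 / real b ^ rfun n x \<and>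
     (fr (Suc n) \<noteq> fr n \<longrightarrow> 1 / real b ^ (rfun n x + Suc K) \<le> \<bar>\<xi> - of_rat y\<bar>)" for n
  proof -
    obtain i where i: "1 \<le> i" "i < fr n" "fac n i = fac n (fr n)"
      using first_repeat_repeats by blast
    define p where "p = fr n - i"
    have p: "0 < p" "fr n = i + p" using i by (auto simp: p_def)
    \<comment> \<open>\<open>w\<close> keeps the digits before \<open>i\<close> and then repeats the
      block from \<open>i\<close> to \<open>fr n - 1\<close>; preperiod and period together have
      length \<open>fr n - 1\<close>.\<close>
    define w where "w k = (if k < i then x k else x (i + (k - i) mod p))" for k
    have w: "digits b w"
      by unfold_locales (use base digit i in \<open>auto simp: w_def\<close>)
    \<comment> \<open>The factors at \<open>i\<close> and \<open>i + p\<close> agree, so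
      \<open>x\<close> has period \<open>p\<close> from \<open>i\<close> up to position
      \<open>rfun n x\<close>, even if the two occurrences overlap.\<close>
    have per: "x (i + t mod p) = x (i + t)" if "t < n + p" for t
      using that
    proof (induction t rule: less_induct)
      case (less t)
      show ?case
      proof (cases "t < p")
        case False
        then have "x (i + (t - p) mod p) = x (i + (t - p))" using less p by auto
        also have "\<dots> = x (fr n + (t - p))" using i(3) less.prems False
          by (auto simp: factor_at_eq_iff simp del: add_diff_assoc)
        also have "fr n + (t - p) = i + t" using p False by simp
        finally show ?thesis using False by (simp add: le_mod_geq)
      qed simp
    qed
    have agree: "x k = w k" if "1 \<le> k" "k \<le> rfun n x" for k
      using that per[of "k - i"] p i unfolding w_def rfun_eq by auto
    have "w (k + p) = w k" if "i - 1 < k" for k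
    proof -
      have "i \<le> k" using that by simp
      moreover from this have "(k + p - i) mod p = (k - i) mod p"
        by (metis mod_add_self2 Nat.add_diff_assoc2)
      ultimately show ?thesis by (simp add: w_def)
    qed
    then obtain y where y: "of_rat y = expansion b w" "denom y \<le> real b ^ (i - 1 + p)"
      using digits.denom_eventually_periodic[OF w, of p "i - 1"] p by auto
    have "i - 1 + p = fr n - 1" using p i by simp
    moreover have "\<bar>\<xi> - expansion b w\<bar> \<le> 1 / real b ^ rfun n x"
      by (intro expansion_close agree w) (simp_all add: digits_axioms)
    moreover have "1 / real b ^ (rfun n x + Suc K) \<le> \<bar>\<xi> - expansion b w\<bar>" if jump: "fr (Suc n) \<noteq> fr n"
    proof -
      let ?m = "rfun n x"
      have m: "Suc ?m = fr n + n" using i by (simp add: rfun_eq)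
      \<comment> \<open>At a jump the repetition does not extend, so the first disagreement is
        exactly at \<open>Suc ?m\<close>; this one position turns \<open>K\<close> into
        \<open>Suc K\<close>.\<close>
      have "fac (Suc n) i \<noteq> fac (Suc n) (fr n)"
        using first_repeat_le[of i "fr n" "Suc n"] i jump first_repeat_mono_Suc[of n] by auto
      then have "x (i + n) \<noteq> x (Suc ?m)" using i m by (simp add: factor_at_Suc_eq_iff)
      moreover have "w (Suc ?m) = x (i + n)"
        using per[of n] p by (simp add: w_def m)
      ultimately have ne: "x (Suc ?m) \<noteq> w (Suc ?m)" by simp
      have sh: "\<exists>k\<in>{1..K}. x (k + Suc ?m) \<noteq> d" if ex: "\<exists>k\<in>{?m + 2..<?m + 2 + K}. x k \<noteq> d" for d
      proof -
        obtain k where "k \<in> {?m + 2..<?m + 2 + K}" "x k \<noteq> d" using ex by blast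
        then show ?thesis by (intro bexI[of _ "k - Suc ?m"]) auto
      qed
      have "1 / real b ^ (Suc ?m + K) \<le> \<bar>\<xi> - expansion b w\<bar>"
        by (intro expansion_apart agree ne w digits_axioms sh) (use K[rule_format, of "?m + 2"] in auto)
      then show ?thesis by simp
    qed
    ultimately show ?thesis using y by (intro exI[of _ y]) auto
  qed
  then show ?thesis by blast
qed

section \<open>From approximants to the irrationality exponent\<close>

lemma ex_jump_after:
  "\<exists>v\<ge>N. fr (Suc v) \<noteq> fr v \<and> (\<exists>u<v. fr (Suc u) \<noteq> fr u \<and> fr v = u + 3)"
proof -
  obtain u\<^sub>0 where "fr (Suc u\<^sub>0) \<noteq> fr u\<^sub>0" using ex_jump_ge by blast
  moreover obtain v where "v \<ge> N + Suc u\<^sub>0" "fr (Suc v) \<noteq> fr v" using ex_jump_ge by blast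
  ultimately show ?thesis using jump_before[of v u\<^sub>0] by (intro exI[of _ v]) auto
qed

text \<open>At a jump \<open>v\<close> preceded by \<open>u\<close>, the approximant differs from
  \<xi>, has denominator at most \<open>b ^ (u + 2)\<close> and error at most
  \<open>1 / b ^ (v + u + 2)\<close>. For rational \<xi> this would bound \<open>b ^ v\<close> by
  \<open>denom r\<close>, for arbitrarily large \<open>v\<close>.\<close>

lemma irrational: "\<xi> \<noteq> of_rat r"
proof
  assume eq: "\<xi> = of_rat r"
  obtain v u where v: "v \<ge> nat \<lceil>denom r\<rceil>" "fr (Suc v) \<noteq> fr v" "u < v" "fr v = u + 3"
    using ex_jump_after by blast
  obtain y K where y: "denom y \<le> real b ^ (fr v - 1)" "\<bar>\<xi> - of_rat y\<bar> \<le> 1 / real b ^ rfun v x"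
    "1 / real b ^ (rfun v x + K) \<le> \<bar>\<xi> - of_rat y\<bar>"
    using approximants v(2) by blast
  have b: "0 < real b ^ k" for k using base by simp
  have d: "1 \<le> denom r" "1 \<le> denom y" by (rule denom_ge_1)+
  have "0 < \<bar>\<xi> - of_rat y\<bar>" using y(3) b[of "rfun v x + K"] by (meson less_le_trans divide_pos_pos zero_less_one)
  then have "1 / (denom r * denom y) \<le> \<bar>\<xi> - of_rat y\<bar>" using eq rat_distance[of r y] by auto
  then have "1 / (denom r * denom y) \<le> 1 / real b ^ rfun v x" using y(2) by linarith
  then have "real b ^ rfun v x \<le> denom r * denom y"
    using b[of "rfun v x"] d by (simp add: field_simps)
  also have "\<dots> \<le> denom r * real b ^ (u + 2)" using y(1) v(4) d by (intro mult_left_mono) auto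
  also have "rfun v x = v + (u + 2)" using v(4) by (simp add: rfun_eq)
  finally have "real b ^ v \<le> denom r" using b[of "u + 2"] by (simp only: power_add mult_le_cancel_right)
  moreover have "denom r \<le> real v" using v(1) by linarith
  moreover have "real v < real b ^ v"
    using base less_exp[of v] power_mono[of 2 b v] by (metis le_eq_less_or_eq less_le_trans nat_less_real_le of_nat_power of_nat_less_iff zero_le)
  ultimately show False by linarith
qed

text \<open>With \<open>a = fr n - 1\<close>, the condition
  \<open>rfun n x / n < \<mu> / (\<mu> - 1)\<close> says \<open>a * \<mu> < n + a\<close>, which is
  what makes the approximant of \<open>n\<close> good enough. It holds for infinitely many
  \<open>n\<close>, and the errors tend to 0 without vanishing.\<close>

lemma infinitely_many_approximations:
  assumes \<mu>: "1 < \<mu>" and rep: "rep x < ereal (\<mu> / (\<mu> - 1))"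
  shows "infinite {r. \<bar>\<xi> - of_rat r\<bar> < denom r powr (- \<mu>)}"
proof
  let ?F = "{r. \<bar>\<xi> - of_rat r\<bar> < denom r powr (- \<mu>)}"
  assume fin: "finite ?F"
  have "\<exists>\<^sub>F n in sequentially. ereal (real (rfun n x) / real n) < ereal (\<mu> / (\<mu> - 1))"
  proof (rule ccontr)
    assume "\<not> ?thesis"
    then have "\<forall>\<^sub>F n in sequentially. ereal (\<mu> / (\<mu> - 1)) \<le> ereal (real (rfun n x) / real n)"
      by (simp add: not_frequently not_less)
    then have "ereal (\<mu> / (\<mu> - 1)) \<le> rep x" unfolding rep_def by (rule Liminf_bounded)
    then show False using rep by simp
  qed
  then have freq: "\<exists>n\<ge>N. real (rfun n x) / real n < \<mu> / (\<mu> - 1)" for N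
    by (simp add: frequently_sequentially)
  \<comment> \<open>The least distance within the supposedly finite set, positive by irrationality;
    the entry 1 covers the empty set.\<close>
  define \<delta> where "\<delta> = Min (insert 1 ((\<lambda>r. \<bar>\<xi> - of_rat r\<bar>) ` ?F))"
  have \<delta>: "0 < \<delta>" using fin irrational by (auto simp: \<delta>_def)
  have \<delta>_le: "\<delta> \<le> \<bar>\<xi> - of_rat r\<bar>" if "r \<in> ?F" for r
    using fin that by (auto simp: \<delta>_def intro!: Min_le)
  obtain N where N: "1 / \<delta> < real b ^ N" using real_arch_pow[of "real b" "1 / \<delta>"] base by auto
  obtain n where n: "n \<ge> Suc N" "real (rfun n x) / real n < \<mu> / (\<mu> - 1)" using freq by blast
  define a where "a = fr n - 1"
  have r: "rfun n x = n + a" by (simp add: rfun_eq a_def)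
  obtain y where y: "denom y \<le> real b ^ a" "\<bar>\<xi> - of_rat y\<bar> \<le> 1 / real b ^ (n + a)"
    using approximants unfolding a_def r[symmetric] by (metis a_def r)
  have "real (n + a) * (\<mu> - 1) < \<mu> * real n" using n \<mu> unfolding r by (simp add: field_simps)
  then have exp: "real a * \<mu> < real (n + a)" by (simp add: algebra_simps)
  have "1 / real b ^ (n + a) = real b powr (- real (n + a))"
    using base by (simp add: powr_minus powr_realpow divide_inverse del: of_nat_add)
  also have "\<dots> < real b powr (- (real a * \<mu>))" using exp base by (intro powr_less_mono) auto
  also have "\<dots> = (real b ^ a) powr (- \<mu>)" using base by (simp add: powr_powr flip: powr_realpow)
  also have "\<dots> \<le> denom y powr (- \<mu>)"
    using y(1) \<mu> denom_ge_1[of y] by (intro powr_mono2') auto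
  finally have "y \<in> ?F" using y(2) by auto
  then have "\<delta> \<le> 1 / real b ^ (n + a)" using \<delta>_le y(2) by force
  also have "\<dots> \<le> 1 / real b ^ N" using base n by (intro divide_left_mono power_increasing) auto
  also have "\<dots> < \<delta>" using N \<delta> base by (simp add: field_simps)
  finally show False by simp
qed

text \<open>A fraction with denominator \<open>q\<close> is compared with the approximant of the first jump \<open>v\<close>
  with \<open>2 q \<le> b ^ v\<close>. Since the previous jump \<open>u\<close> satisfies \<open>b ^ u < 2 q\<close> and the approximant
  has denominator at most \<open>b ^ (u + 2)\<close>, any other fraction is no better than \<open>q powr (-2)\<close> up
  to a constant; and if the fraction is the approximant itself, cancellation in it can only have
  cost a constant factor.\<close>

lemma finitely_many_approximations:
  assumes \<mu>\<^sub>1: "2 \<le> \<mu>\<^sub>1" and rep: "ereal (\<mu>\<^sub>1 / (\<mu>\<^sub>1 - 1)) < rep x" and \<mu>: "\<mu>\<^sub>1 < \<mu>"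
  shows "finite {r. \<bar>\<xi> - of_rat r\<bar> < denom r powr (- \<mu>)}"
proof -
  obtain K where K: "\<And>n. \<exists>y. denom y \<le> real b ^ (fr n - 1) \<and> \<bar>\<xi> - of_rat y\<bar> \<le> 1 / real b ^ rfun n x \<and>
     (fr (Suc n) \<noteq> fr n \<longrightarrow> 1 / real b ^ (rfun n x + K) \<le> \<bar>\<xi> - of_rat y\<bar>)"
    using approximants by metis
  have "\<forall>\<^sub>F n in sequentially. ereal (\<mu>\<^sub>1 / (\<mu>\<^sub>1 - 1)) < ereal (real (rfun n x) / real n)"
    using rep unfolding rep_def by (rule less_LiminfD)
  then obtain N where N: "\<And>n. n \<ge> N \<Longrightarrow> \<mu>\<^sub>1 / (\<mu>\<^sub>1 - 1) < real (rfun n x) / real n"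
    by (auto simp: eventually_sequentially)
  obtain u\<^sub>0 where u\<^sub>0: "fr (Suc u\<^sub>0) \<noteq> fr u\<^sub>0" using ex_jump_ge by blast
  \<comment> \<open>Dictated by the case \<open>r = y\<close>: \<open>b ^ K\<close> comes from the
    lower bound at the jump, \<open>2 * b ^ 2\<close> from \<open>bu2\<close>. The other case needs
    only \<open>4 * b ^ 2 \<le> C\<close>.\<close>
  define C where "C = real b ^ K * (2 * real b ^ 2) powr \<mu>\<^sub>1"
  \<comment> \<open>The first entry forces \<open>v\<close> past \<open>N\<close> and past the jump
    \<open>u\<^sub>0\<close>; the second lets \<open>q powr (\<mu> - \<mu>\<^sub>1)\<close> absorb
    \<open>C\<close>.\<close>
  define B where "B = max (real b ^ (N + u\<^sub>0 + 1)) (C powr (1 / (\<mu> - \<mu>\<^sub>1)))"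
  have b: "1 < real b" "0 < real b" using base by auto
  have C: "4 * real b ^ 2 \<le> C"
  proof -
    have b2: "1 \<le> real b ^ 2" using b by simp
    have "4 * real b ^ 2 \<le> 4 * real b ^ 2 * real b ^ 2"
      using b2 mult_left_mono[OF b2, of "4 * real b ^ 2"] by simp
    also have "\<dots> = (2 * real b ^ 2) powr 2" using b by (simp add: power2_eq_square)
    also have "\<dots> \<le> (2 * real b ^ 2) powr \<mu>\<^sub>1" using b2 \<mu>\<^sub>1 by (intro powr_mono) auto
    also have "\<dots> \<le> C" using b mult_right_mono[of 1 "real b ^ K" "(2 * real b ^ 2) powr \<mu>\<^sub>1"]
      by (simp add: C_def)
    finally show ?thesis .
  qed
  have C0: "0 < C" using C b by (smt (verit) zero_less_power)
  have bound: "denom r powr (- \<mu>) \<le> \<bar>\<xi> - of_rat r\<bar>" if "B < denom r" for r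
  proof -
    define q where "q = denom r"
    have q: "1 \<le> q" "B < q" using denom_ge_1 that by (auto simp: q_def)
    define P where "P v \<longleftrightarrow> fr (Suc v) \<noteq> fr v \<and> 2 * q \<le> real b ^ v" for v
    define v where "v = (LEAST v. P v)"
    have "\<exists>v. P v"
    proof -
      obtain n where n: "2 * q < real b ^ n" using real_arch_pow b by blast
      obtain v where "v \<ge> n" "fr (Suc v) \<noteq> fr v" using ex_jump_ge by blast
      moreover from this have "real b ^ n \<le> real b ^ v" using b by (intro power_increasing) auto
      ultimately show ?thesis using n by (auto simp: P_def intro!: exI[of _ v])
    qed
    then have v: "P v" unfolding v_def by (rule LeastI_ex)
    have "real b ^ (N + u\<^sub>0 + 1) < real b ^ v" using v q by (auto simp: P_def B_def)
    then have vN: "N + u\<^sub>0 + 1 < v" using b by (simp only: power_strict_increasing_iff)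
    obtain u where u: "u < v" "fr (Suc u) \<noteq> fr u" "fr v = u + 3"
      using jump_before[of v u\<^sub>0] vN u\<^sub>0 v by (auto simp: P_def)
    have "\<not> P u" using u(1) not_less_Least unfolding v_def by blast
    then have bu: "real b ^ u < 2 * q" using u by (auto simp: P_def)
    then have "real b ^ u * real b ^ 2 \<le> 2 * q * real b ^ 2" by (intro mult_right_mono) auto
    then have bu2: "real b ^ (u + 2) \<le> 2 * real b ^ 2 * q" by (simp only: power_add mult_ac)
    have rv: "rfun v x = v + (u + 2)" using u(3) by (simp add: rfun_eq)
    obtain y where y: "denom y \<le> real b ^ (u + 2)" "\<bar>\<xi> - of_rat y\<bar> \<le> 1 / real b ^ (v + (u + 2))"
      "1 / real b ^ (v + (u + 2) + K) \<le> \<bar>\<xi> - of_rat y\<bar>"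
      using K[of v] v u(3) by (auto simp: P_def rv)
    have "1 / (C * q powr \<mu>\<^sub>1) \<le> \<bar>\<xi> - of_rat r\<bar>"
    proof (cases "r = y")
      case True
      have "\<mu>\<^sub>1 / (\<mu>\<^sub>1 - 1) < real (v + (u + 2)) / real v" using N[of v] vN rv by simp
      \<comment> \<open>Clearing denominators turns the lower bound on \<open>rfun v x / v\<close>
        into an upper bound on \<open>rfun v x\<close> by a multiple of
        \<open>u + 2\<close>.\<close>
      then have exp: "real (v + (u + 2)) \<le> real (u + 2) * \<mu>\<^sub>1"
        using vN \<mu>\<^sub>1 by (simp add: field_simps)
      have "real b ^ (v + (u + 2)) = real b powr real (v + (u + 2))" using b by (simp only: powr_realpow)
      also have "\<dots> \<le> real b powr (real (u + 2) * \<mu>\<^sub>1)" using exp b by (intro powr_mono) auto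
      also have "\<dots> = (real b ^ (u + 2)) powr \<mu>\<^sub>1" using b by (simp only: powr_powr flip: powr_realpow)
      also have "\<dots> \<le> (2 * real b ^ 2 * q) powr \<mu>\<^sub>1" using bu2 b \<mu>\<^sub>1 by (intro powr_mono2) auto
      also have "\<dots> = (2 * real b ^ 2) powr \<mu>\<^sub>1 * q powr \<mu>\<^sub>1" using q by (simp add: powr_mult)
      finally have "real b ^ (v + (u + 2) + K) \<le> C * q powr \<mu>\<^sub>1"
        using mult_left_mono[of _ _ "real b ^ K"] b unfolding C_def power_add[of _ _ K]
        by (simp add: mult_ac)
      then have "1 / (C * q powr \<mu>\<^sub>1) \<le> 1 / real b ^ (v + (u + 2) + K)"
        using b C0 q by (intro divide_left_mono) auto
      then show ?thesis using y(3) True by simp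
    next
      case False
      have pos: "0 < real b ^ (u + 2)" "0 < denom y" using b denom_ge_1[of y] by auto
      have "1 / (q * real b ^ (u + 2)) \<le> 1 / (denom r * denom y)"
        unfolding q_def[symmetric] using y(1) q pos by (intro divide_left_mono mult_left_mono) auto
      also have "\<dots> \<le> \<bar>of_rat r - of_rat y\<bar>" by (rule rat_distance[OF False])
      also have "\<dots> \<le> \<bar>\<xi> - of_rat r\<bar> + 1 / real b ^ (v + (u + 2))" using y(2) by linarith
      \<comment> \<open>Here \<open>2 * q \<le> b ^ v\<close> is used: the error of \<open>y\<close>
        is at most half of the bound for the distance between \<open>r\<close> and
        \<open>y\<close>.\<close>
      also have "\<dots> \<le> \<bar>\<xi> - of_rat r\<bar> + 1 / (2 * q * real b ^ (u + 2))"
        unfolding power_add[of _ v] using v q pos b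
        by (intro add_left_mono divide_left_mono mult_right_mono) (auto simp: P_def)
      finally have "1 / (q * real b ^ (u + 2)) - 1 / (2 * q * real b ^ (u + 2)) \<le> \<bar>\<xi> - of_rat r\<bar>"
        by (simp only: diff_le_eq)
      moreover have "1 / (q * real b ^ (u + 2)) - 1 / (2 * q * real b ^ (u + 2)) = 1 / (2 * q * real b ^ (u + 2))"
        using q pos(1) by (simp add: field_simps del: power_add)
      moreover have "1 / (C * q powr \<mu>\<^sub>1) \<le> 1 / (2 * q * real b ^ (u + 2))"
      proof (intro divide_left_mono)
        have "2 * q * real b ^ (u + 2) \<le> 2 * q * (2 * real b ^ 2 * q)"
          using bu2 q by (intro mult_left_mono) auto
        also have "\<dots> = 4 * real b ^ 2 * q powr 2" using q by (simp add: power2_eq_square)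
        also have "\<dots> \<le> C * q powr \<mu>\<^sub>1"
          using C \<mu>\<^sub>1 q C0 by (intro mult_mono powr_mono) auto
        finally show "2 * q * real b ^ (u + 2) \<le> C * q powr \<mu>\<^sub>1" .
      qed (use q pos C0 in auto)
      ultimately show ?thesis by linarith
    qed
    moreover have "q powr (- \<mu>) \<le> 1 / (C * q powr \<mu>\<^sub>1)"
    proof -
      have "C = (C powr (1 / (\<mu> - \<mu>\<^sub>1))) powr (\<mu> - \<mu>\<^sub>1)" using C0 \<mu> by (simp add: powr_powr)
      also have "\<dots> \<le> q powr (\<mu> - \<mu>\<^sub>1)" using q \<mu> by (intro powr_mono2) (auto simp: B_def)
      finally have "C * q powr \<mu>\<^sub>1 \<le> q powr (\<mu> - \<mu>\<^sub>1) * q powr \<mu>\<^sub>1" by (intro mult_right_mono) auto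
      also have "\<dots> = q powr \<mu>" by (simp flip: powr_add)
      finally show ?thesis using C0 q by (simp add: powr_minus_divide field_simps)
    qed
    ultimately show ?thesis by (simp add: q_def)
  qed
  have "{r. \<bar>\<xi> - of_rat r\<bar> < denom r powr (- \<mu>)} \<subseteq> {r. \<bar>\<xi> - of_rat r\<bar> \<le> 1 \<and> denom r \<le> B}"
  proof safe
    fix r assume r: "\<bar>\<xi> - of_rat r\<bar> < denom r powr (- \<mu>)"
    have "denom r powr (- \<mu>) \<le> denom r powr 0"
      using denom_ge_1[of r] \<mu> \<mu>\<^sub>1 by (intro powr_mono) auto
    then show "\<bar>\<xi> - of_rat r\<bar> \<le> 1" using r denom_ge_1[of r] by simp
    show "denom r \<le> B" using bound[of r] r by (meson not_le)
  qed
  then show ?thesis using finite_bounded_denom finite_subset by blast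
qed

text \<open>\<open>rfun n x\<close> lies between \<open>n\<close> and \<open>2 * n + 1\<close>. The
  bound 2 makes the claimed exponent at least 2, as the finiteness argument requires.\<close>

lemma rep_bounds: "1 \<le> rep x" "rep x \<le> 2"
proof -
  show "1 \<le> rep x" unfolding rep_def
    by (intro Liminf_bounded eventually_sequentiallyI[of 1]) (auto simp: rfun_eq one_ereal_def)
  have "(\<lambda>n. ereal (2 + 1 / real n)) \<longlonglongrightarrow> ereal (2 + 0)"
    by (intro tendsto_intros lim_1_over_n)
  then have lim: "liminf (\<lambda>n. ereal (2 + 1 / real n)) = ereal 2"
    using lim_imp_Liminf by force
  have "rep x \<le> liminf (\<lambda>n. ereal (2 + 1 / real n))"
    unfolding rep_def
  proof (intro Liminf_mono eventually_sequentiallyI[of 1])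
    fix n :: nat assume "1 \<le> n"
    moreover have "real (rfun n x) \<le> 2 * real n + 1" using first_repeat_bound[of n] by (simp add: rfun_eq)
    ultimately show "ereal (real (rfun n x) / real n) \<le> ereal (2 + 1 / real n)" by (simp add: field_simps)
  qed
  then show "rep x \<le> 2" using lim by simp
qed

text \<open>The map t to t / (t - 1) is a decreasing involution of the reals above 1, so bounds on
  \<open>rep x\<close> become bounds on the exponent. For \<open>rep x = 1\<close> every exponent
  above 1 is admissible.\<close>

lemma irrationality_exponent_eq:
  "irrationality_exponent \<xi> = (if rep x = 1 then \<infinity> else rep x / (rep x - 1))"
proof -
  let ?S = "{\<mu>. infinite {r. \<bar>\<xi> - of_rat r\<bar> < denom r powr (- \<mu>)}}"
  have Sup: "irrationality_exponent \<xi> = Sup (ereal ` ?S)"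
    by (simp add: irrationality_exponent_def denom_def)
  obtain R where R: "rep x = ereal R" "1 \<le> R" "R \<le> 2"
    using rep_bounds by (cases "rep x") (auto simp: one_ereal_def)
  have lower: "ereal \<mu> \<le> Sup (ereal ` ?S)" if "1 < \<mu>" "R < \<mu> / (\<mu> - 1)" for \<mu>
    using infinitely_many_approximations[of \<mu>] that R by (intro Sup_upper) auto
  show ?thesis
  proof (cases "R = 1")
    case True
    have "Sup (ereal ` ?S) = \<infinity>"
    proof (rule ereal_top)
      fix M :: real
      have "ereal M \<le> ereal (max M 2)" by simp
      also have "\<dots> \<le> Sup (ereal ` ?S)" using True by (intro lower) (auto simp: field_simps)
      finally show "ereal M \<le> Sup (ereal ` ?S)" .
    qed
    then show ?thesis using True R Sup by (simp add: one_ereal_def)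
  next
    case False
    then have R1: "1 < R" using R by simp
    define E where "E = R / (R - 1)"
    have E: "2 \<le> E" using R R1 by (simp add: E_def field_simps)
    have RE: "R = E / (E - 1)" using R1 by (simp add: E_def field_simps)
    have "Sup (ereal ` ?S) \<le> ereal E"
    proof (rule Sup_least)
      fix z assume "z \<in> ereal ` ?S"
      then obtain \<mu> where z: "z = ereal \<mu>" and inf: "\<mu> \<in> ?S" by blast
      have "\<mu> \<le> E"
      proof (rule ccontr)
        assume "\<not> \<mu> \<le> E"
        \<comment> \<open>The intermediate exponent leaves the room in which constant factors are
          absorbed.\<close>
        then obtain \<mu>\<^sub>1 where m: "E < \<mu>\<^sub>1" "\<mu>\<^sub>1 < \<mu>" using dense[of E \<mu>] by auto
        then have "\<mu>\<^sub>1 / (\<mu>\<^sub>1 - 1) < R" unfolding RE using E by (simp add: field_simps)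
        then show False using finitely_many_approximations[of \<mu>\<^sub>1 \<mu>] m E R inf by auto
      qed
      then show "z \<le> ereal E" using z by simp
    qed
    moreover have "ereal E \<le> Sup (ereal ` ?S)"
    proof (rule dense_le_bounded[of "ereal 1"])
      show "ereal 1 < ereal E" using E by simp
      fix z assume z: "ereal 1 < z" "z < ereal E"
      then obtain \<mu> where \<mu>: "z = ereal \<mu>" "1 < \<mu>" "\<mu> < E" by (cases z) auto
      then have "R < \<mu> / (\<mu> - 1)" unfolding RE using E by (simp add: field_simps)
      then show "z \<le> Sup (ereal ` ?S)" using lower \<mu> by simp
    qed
    ultimately have "Sup (ereal ` ?S) = ereal E" by simp
    then show ?thesis using R R1 Sup by (simp add: one_ereal_def E_def)
  qed
qed

end

theorem theorem4p5:
  fixes b :: nat and x :: "nat \<Rightarrow> nat"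
  assumes "b \<ge> 2"
    and "\<forall>k\<ge>1. x k < b"
    and "sturmian x"
  shows "irrationality_exponent (\<Sum>k. real (x (Suc k)) / real b ^ Suc k) =
    (if rep x = 1 then \<infinity> else rep x / (rep x - 1))"
proof -
  interpret sturmian_number b x
    by unfold_locales (use assms in auto)
  show ?thesis using irrationality_exponent_eq by (simp only: expansion_def)
qed

end
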